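(* Let $Y$ be a compact Hausdorff space without isolated points and $A\subseteq Y$ finite and nonempty. Then: (i) (KIP holds for $\mathcal{D}_Y$) In $\mathrm{FMQ}(Y,A,\mathcal{D}_Y)$, every open neighborhood of $\ast$ is dense, hence meets every nonempty open set. (ii) (KIP fails beyond $\mathcal{D}_Y$) For any admissible modifier $\mathcal{F}\supsetneq\mathcal{D}_Y$, the KIP fails: there exists a non-dense open neighborhood of $\ast$ in $\mathrm{FMQ}(Y,A,\mathcal{F})$. (iii) (Hausdorff recovery) $\mathcal{F}_{\mathrm{acc}}$ and $\mathcal{P}(Y)$ both produce Hausdorff spaces, i.e. $\mathrm{FMQ}(Y,A,\mathcal{F}_{\mathrm{acc}})$ and $\mathrm{FMQ}(Y,A,\mathcal{P}(Y))$ are Hausdorff. (iv) (US zone boundary) Below $\mathcal{D}_Y$, US may or may not hold. The comeager modifier $\mathcal{F}_{\mathrm{com}}$ satisfies $(\mathrm{US}_{\mathcal{F}})$; the cofinite modifier $\mathcal{F}_{\mathrm{cof}}$ does not. In summary, $\mathcal{D}_Y$ is the least restrictive admissible modifier for which the KIP holds.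
   Context: Admissible modifier: for a topological space $(Y,\tau)$, a collection $\mathcal{F}\subseteq\mathcal{P}(Y)$, where $\mathcal{P}(Y)$ is the power set of $Y$, is ($\tau$-)admissible if (F1) $Y\in\mathcal{F}$; (F2) $F\in\mathcal{F}$ and $F\subseteq G\subseteq Y$ imply $G\in\mathcal{F}$; (F3) if $U_1,U_2\in\mathcal{F}\cap\tau$ then $U_1\cap U_2\in\mathcal{F}$. A larger collection is a less restrictive modifier. Filter-Modified Quotient: for nonempty $A\subseteq Y$, let $q\colon Y\to Y/A$ be the projection (of sets) collapsing $A$ to one point $\ast=q(A)$. Then $\mathrm{FMQ}(Y,A,\mathcal{F})$ is the set $Y/A$ with the topology $\tau_{\mathcal{F}}$ of all $U\subseteq Y/A$ such that $q^{-1}(U)$ is open in $Y$ and ($\ast\in U\Rightarrow q^{-1}(U)\in\mathcal{F}$). Modifiers: $\mathcal{D}_Y=\{D\subseteq Y:\overline{D}=Y\}$ (dense sets); $\mathcal{F}_{\mathrm{com}}=\{S\subseteq Y: Y\setminus S\text{ is meager}\}$; $\mathcal{F}_{\mathrm{cof}}=\{S\subseteq Y: Y\setminus S\text{ is finite}\}$; $\mathcal{F}_{\mathrm{acc}}=\{S\subseteq Y:\text{every }a\in A\text{ is an accumulation point of }S\}$. The collection $\mathcal{F}_{\mathrm{acc}}$ satisfies (F1), (F2), and (F3) for pairs of open sets containing $A$, which suffices for $\tau_{\mathcal{F}_{\mathrm{acc}}}$ to be a topology. KIP (key intersection principle) for $\mathrm{FMQ}(Y,A,\mathcal{F})$: every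 open neighborhood of $\ast$ meets every nonempty open set (i.e. is dense). A space is US if every convergent sequence has a unique limit. Condition $(\mathrm{US}_{\mathcal{F}})$ on a modifier $\mathcal{F}$: for every convergent sequence $z_n\to c\in Y\setminus A$ in $Y$, $Y\setminus(\{z_n\}\cup\{c\})\in\mathcal{F}$, where $\{z_n\}$ denotes the set of all terms of the sequence.
   Formalization: In (iv), failure of (US_F) for the cofinite modifier is claimed only if Y is first countable or some sequence with infinitely many distinct terms converges to a point of Y∖A; it is false for Y = βℕ∖ℕ, where convergent sequences are eventually constant. *)

theory Defs
  imports "HOL-Analysis.Analysis"
begin

definition no_isolated_points :: "'a topology \<Rightarrow> bool" where
  "no_isolated_points Y \<longleftrightarrow> (\<forall>y \<in> topspace Y. \<not> openin Y {y})"

definition dense_in_space :: "'a topology \<Rightarrow> 'a set \<Rightarrow> bool" where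
  "dense_in_space Y D \<longleftrightarrow> D \<subseteq> topspace Y \<and> Y closure_of D = topspace Y"

definition nowhere_dense_in :: "'a topology \<Rightarrow> 'a set \<Rightarrow> bool" where
  "nowhere_dense_in Y N \<longleftrightarrow> N \<subseteq> topspace Y \<and> Y interior_of (Y closure_of N) = {}"

definition meager_in :: "'a topology \<Rightarrow> 'a set \<Rightarrow> bool" where
  "meager_in Y M \<longleftrightarrow>
     (\<exists>\<N>. countable \<N> \<and> (\<forall>N \<in> \<N>. nowhere_dense_in Y N) \<and> M = \<Union>\<N>)"

definition US_space :: "'a topology \<Rightarrow> bool" where
  "US_space Z \<longleftrightarrow>
     (\<forall>s l m. range s \<subseteq> topspace Z \<and> limitin Z s l sequentially \<and> limitin Z s m sequentially
        \<longrightarrow> l = m)"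

definition admissible :: "'a topology \<Rightarrow> 'a set set \<Rightarrow> bool" where
  "admissible Y \<F> \<longleftrightarrow>
     \<F> \<subseteq> Pow (topspace Y) \<and>
     topspace Y \<in> \<F> \<and>
     (\<forall>F G. F \<in> \<F> \<and> F \<subseteq> G \<and> G \<subseteq> topspace Y \<longrightarrow> G \<in> \<F>) \<and>
     (\<forall>U V. U \<in> \<F> \<and> openin Y U \<and> V \<in> \<F> \<and> openin Y V \<longrightarrow> U \<inter> V \<in> \<F>)"

text \<open>The quotient set \<open>Y/A\<close> consists of the equivalence classes of the relation that identifies
  all points of \<open>A\<close>. Thus the point \<open>* = q(A)\<close> is the class \<open>A\<close> itself, and every
  other point is a singleton class \<open>{y}\<close> with \<open>y\<close> outside \<open>A\<close>.\<close>

definition collapse :: "'a set \<Rightarrow> 'a \<Rightarrow> 'a set" where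
  "collapse A y = (if y \<in> A then A else {y})"

definition fmq_open :: "'a topology \<Rightarrow> 'a set \<Rightarrow> 'a set set \<Rightarrow> 'a set set \<Rightarrow> bool" where
  "fmq_open Y A \<F> U \<longleftrightarrow>
     U \<subseteq> collapse A ` topspace Y \<and>
     openin Y {y \<in> topspace Y. collapse A y \<in> U} \<and>
     (A \<in> U \<longrightarrow> {y \<in> topspace Y. collapse A y \<in> U} \<in> \<F>)"

text \<open>The constant \<open>topology\<close> is only meaningful on predicates satisfying \<open>istopology\<close>;
  the lemmas \<open>openin_FMQ\<close> and \<open>openin_FMQ_acc\<close> below show that this is the case for every
  admissible \<open>\<F>\<close> and for \<open>F_acc\<close>.\<close>

definition FMQ :: "'a topology \<Rightarrow> 'a set \<Rightarrow> 'a set set \<Rightarrow> 'a set topology" where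
  "FMQ Y A \<F> = topology (fmq_open Y A \<F>)"

definition D_dense :: "'a topology \<Rightarrow> 'a set set" where
  "D_dense Y = {D. dense_in_space Y D}"

definition F_com :: "'a topology \<Rightarrow> 'a set set" where
  "F_com Y = {S. S \<subseteq> topspace Y \<and> meager_in Y (topspace Y - S)}"

definition F_cof :: "'a topology \<Rightarrow> 'a set set" where
  "F_cof Y = {S. S \<subseteq> topspace Y \<and> finite (topspace Y - S)}"

definition F_acc :: "'a topology \<Rightarrow> 'a set \<Rightarrow> 'a set set" where
  "F_acc Y A = {S. S \<subseteq> topspace Y \<and> (\<forall>a \<in> A. a \<in> Y derived_set_of S)}"

definition KIP :: "'a topology \<Rightarrow> 'a set \<Rightarrow> 'a set set \<Rightarrow> bool" where
  "KIP Y A \<F> \<longleftrightarrow>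
     (\<forall>U V. openin (FMQ Y A \<F>) U \<and> A \<in> U \<and> openin (FMQ Y A \<F>) V \<and> V \<noteq> {}
        \<longrightarrow> U \<inter> V \<noteq> {})"

definition US_modifier :: "'a topology \<Rightarrow> 'a set \<Rightarrow> 'a set set \<Rightarrow> bool" where
  "US_modifier Y A \<F> \<longleftrightarrow>
     (\<forall>z c. range z \<subseteq> topspace Y \<and> c \<in> topspace Y - A \<and> limitin Y z c sequentially
        \<longrightarrow> topspace Y - (range z \<union> {c}) \<in> \<F>)"

lemma istopology_fmq_open:
  assumes ne: "A \<noteq> {}" "A \<subseteq> topspace Y"
    and F1: "topspace Y \<in> \<F>"
    and F2: "\<And>F G. F \<in> \<F> \<Longrightarrow> F \<subseteq> G \<Longrightarrow> G \<subseteq> topspace Y \<Longrightarrow> G \<in> \<F>"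
    and F3: "\<And>U V. openin Y U \<Longrightarrow> openin Y V \<Longrightarrow> A \<subseteq> U \<Longrightarrow> A \<subseteq> V \<Longrightarrow> U \<in> \<F> \<Longrightarrow> V \<in> \<F>
              \<Longrightarrow> U \<inter> V \<in> \<F>"
  shows "istopology (fmq_open Y A \<F>)"
proof -
  let ?p = "\<lambda>U. {y \<in> topspace Y. collapse A y \<in> U}"
  have A: "A \<subseteq> ?p U" if "A \<in> U" for U
    using that ne by (auto simp: collapse_def)
  have "fmq_open Y A \<F> (U \<inter> V)" if U: "fmq_open Y A \<F> U" and V: "fmq_open Y A \<F> V" for U V
  proof -
    have "?p (U \<inter> V) = ?p U \<inter> ?p V" by auto
    then show ?thesis
      using U V F3[of "?p U" "?p V"] A[of U] A[of V] unfolding fmq_open_def by auto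
  qed
  moreover have "fmq_open Y A \<F> (\<Union>\<U>)" if \<U>: "\<And>U. U \<in> \<U> \<Longrightarrow> fmq_open Y A \<F> U" for \<U>
  proof -
    have "?p (\<Union>\<U>) = \<Union>(?p ` \<U>)" by auto
    moreover have "openin Y (\<Union>(?p ` \<U>))"
      using \<U> by (auto simp: fmq_open_def)
    moreover have "?p (\<Union>\<U>) \<in> \<F>" if "A \<in> \<Union>\<U>"
    proof -
      from that obtain U where "U \<in> \<U>" "A \<in> U" by auto
      then show ?thesis
        using \<U>[of U] by (intro F2[of "?p U" "?p (\<Union>\<U>)"]) (auto simp: fmq_open_def)
    qed
    moreover have "\<Union>\<U> \<subseteq> collapse A ` topspace Y"
      using \<U> by (auto simp: fmq_open_def)
    ultimately show ?thesis unfolding fmq_open_def by simp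
  qed
  ultimately show ?thesis unfolding istopology_def by blast
qed

lemma openin_FMQ:
  assumes "A \<noteq> {}" "A \<subseteq> topspace Y" "admissible Y \<F>"
  shows "openin (FMQ Y A \<F>) = fmq_open Y A \<F>"
  unfolding FMQ_def
  using assms by (intro topology_inverse' istopology_fmq_open) (auto simp: admissible_def)

lemma openin_FMQ_acc:
  assumes "A \<noteq> {}" "A \<subseteq> topspace Y" "no_isolated_points Y"
  shows "openin (FMQ Y A (F_acc Y A)) = fmq_open Y A (F_acc Y A)"
  unfolding FMQ_def
proof (intro topology_inverse' istopology_fmq_open)
  show "topspace Y \<in> F_acc Y A"
  proof -
    have "\<exists>y. y \<noteq> a \<and> y \<in> topspace Y \<and> y \<in> T" if "a \<in> A" "a \<in> T" "openin Y T" for a T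
    proof (rule ccontr)
      assume "\<not> ?thesis"
      then have "T = {a}" using that openin_subset[of Y T] by auto
      then show False using that assms by (auto simp: no_isolated_points_def)
    qed
    then show ?thesis using assms by (force simp: F_acc_def derived_set_of_def)
  qed
next
  fix F G assume "F \<in> F_acc Y A" "F \<subseteq> G" "G \<subseteq> topspace Y"
  then show "G \<in> F_acc Y A"
    using derived_set_of_mono[of F G Y] by (auto simp: F_acc_def)
next
  fix U V assume UV: "openin Y U" "openin Y V" "A \<subseteq> U" "A \<subseteq> V" "U \<in> F_acc Y A" "V \<in> F_acc Y A"
  have "a \<in> Y derived_set_of (U \<inter> V)" if a: "a \<in> A" for a
    unfolding derived_set_of_def
  proof safe
    show "a \<in> topspace Y" using a assms by auto
    fix T assume T: "a \<in> T" "openin Y T"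
    have "openin Y (T \<inter> V)" "a \<in> T \<inter> V" using T UV a by auto
    moreover have "a \<in> Y derived_set_of U" using UV a by (auto simp: F_acc_def)
    ultimately obtain y where "y \<noteq> a" "y \<in> U" "y \<in> T \<inter> V"
      unfolding derived_set_of_def by blast
    then show "\<exists>y. y \<noteq> a \<and> y \<in> U \<inter> V \<and> y \<in> T" by auto
  qed
  then show "U \<inter> V \<in> F_acc Y A" using UV by (auto simp: F_acc_def)
qed (use assms in auto)

lemma topspace_FMQ:
  assumes "A \<noteq> {}" "A \<subseteq> topspace Y" "topspace Y \<in> \<F>"
    and "openin (FMQ Y A \<F>) = fmq_open Y A \<F>"
  shows "topspace (FMQ Y A \<F>) = collapse A ` topspace Y"
proof -
  have "{y \<in> topspace Y. collapse A y \<in> collapse A ` topspace Y} = topspace Y" by auto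
  then have "fmq_open Y A \<F> (collapse A ` topspace Y)"
    using assms by (simp add: fmq_open_def)
  then have "openin (FMQ Y A \<F>) (collapse A ` topspace Y)"
    using assms(4) by simp
  moreover have "U \<subseteq> collapse A ` topspace Y" if "openin (FMQ Y A \<F>) U" for U
    using that assms(4) by (simp add: fmq_open_def)
  ultimately show ?thesis
    by (metis openin_subset openin_topspace subset_antisym)
qed

end

theory Submission
  imports Defs
begin

text \<open>For open \<open>V \<supseteq> A\<close> the image \<open>q(V)\<close> is a neighbourhood of \<open>*\<close> as soon as \<open>V \<in> \<F>\<close>. A member
  \<open>S\<close> of \<open>\<F>\<close> that is not dense therefore yields a neighbourhood of \<open>*\<close> that is not dense: since \<open>Y\<close>
  has no isolated points, the complement of the closure of \<open>S\<close> contains a point \<open>p\<close> off \<open>A\<close>, and by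
  regularity \<open>S \<union> A\<close> misses the closure of a neighbourhood of \<open>p\<close>; remove that closure from \<open>Y\<close>.
  A convergent sequence with limit \<open>c\<close> off \<open>A\<close> has limit \<open>*\<close> as well only if the complement
  of its terms and its limit is not in \<open>\<F>\<close>. By the Baire category theorem comeager sets are dense, and
  removing a countable set preserves comeagerness.\<close>

section \<open>Spaces without isolated points\<close>

text \<open>Finite sets are closed in a T1 space, so all but one point of a finite open set could be
  removed, leaving an isolated point.\<close>

lemma infinite_openin_no_isolated_points:
  assumes "t1_space Y" "no_isolated_points Y" "openin Y U" "U \<noteq> {}"
  shows "infinite U"
proof
  assume fin: "finite U"
  obtain x where x: "x \<in> U" using assms(4) by blast
  have "closedin Y (U - {x})"
    using assms fin openin_subset[OF assms(3)] by (auto simp: t1_space_closedin_finite)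
  then have "openin Y (U - (U - {x}))"
    using assms(3) by blast
  moreover have "U - (U - {x}) = {x}" using x by auto
  ultimately show False
    using assms(2) x openin_subset[OF assms(3)] by (auto simp: no_isolated_points_def)
qed

text \<open>Near each point of \<open>A\<close> the set \<open>U\<close> has infinitely many points.
  So accumulation restricts no open set around \<open>A\<close>, and for nonempty \<open>A\<close>
  the modifiers \<open>F_acc\<close> and \<open>Pow (topspace Y)\<close> give the same
  topology.\<close>

lemma openin_subset_F_acc:
  assumes "t1_space Y" "no_isolated_points Y" "openin Y U" "A \<subseteq> U"
  shows "U \<in> F_acc Y A"
proof -
  have "\<exists>y. y \<noteq> a \<and> y \<in> U \<and> y \<in> T" if "a \<in> A" "a \<in> T" "openin Y T" for a T
  proof -
    have "infinite (U \<inter> T)"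
      using assms that by (intro infinite_openin_no_isolated_points[of Y]) auto
    then have "\<not> U \<inter> T \<subseteq> {a}" by (meson finite.emptyI finite_insert finite_subset)
    then show ?thesis by auto
  qed
  then show ?thesis
    using assms openin_subset[OF assms(3)] by (auto simp: F_acc_def derived_set_of_def)
qed

section \<open>Admissible modifiers\<close>

lemma dense_in_space_iff:
  "dense_in_space Y D \<longleftrightarrow> D \<subseteq> topspace Y \<and> (\<forall>T. openin Y T \<and> T \<noteq> {} \<longrightarrow> D \<inter> T \<noteq> {})"
  by (simp add: dense_in_space_def dense_intersects_open)

text \<open>The intersection axiom rests on openness: \<open>V \<inter> T\<close> is again open and
  nonempty, so the dense set \<open>U\<close> meets it.\<close>

lemma admissible_D_dense: "admissible Y (D_dense Y)"
proof -
  have "dense_in_space Y (U \<inter> V)"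
    if U: "dense_in_space Y U" "openin Y U" and V: "dense_in_space Y V" "openin Y V" for U V
    unfolding dense_in_space_iff
  proof (intro conjI allI impI)
    fix T assume T: "openin Y T \<and> T \<noteq> {}"
    then have "V \<inter> T \<noteq> {}" "openin Y (V \<inter> T)" using V by (auto simp: dense_in_space_iff)
    then have "U \<inter> (V \<inter> T) \<noteq> {}" using U by (auto simp: dense_in_space_iff)
    then show "U \<inter> V \<inter> T \<noteq> {}" by (simp add: Int_assoc)
  qed (use U in \<open>auto simp: dense_in_space_iff\<close>)
  moreover have "dense_in_space Y G" if "dense_in_space Y F" "F \<subseteq> G" "G \<subseteq> topspace Y" for F G
    using that unfolding dense_in_space_iff by fast
  moreover have "dense_in_space Y (topspace Y)"
    by (simp add: dense_in_space_def)
  ultimately show ?thesis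
    unfolding admissible_def D_dense_def by (auto simp: dense_in_space_def)
qed

text \<open>The most restrictive admissible modifier, which later provides a quotient that is not
  US.\<close>

lemma admissible_singleton_topspace: "admissible Y {topspace Y}"
  by (auto simp: admissible_def)

lemma admissible_Pow: "admissible Y (Pow (topspace Y))"
  by (auto simp: admissible_def)

section \<open>Meager sets and the comeager modifier\<close>

lemma meager_in_subset:
  assumes "meager_in Y M" "N \<subseteq> M"
  shows "meager_in Y N"
proof -
  obtain \<N> where \<N>: "countable \<N>" "\<And>K. K \<in> \<N> \<Longrightarrow> nowhere_dense_in Y K" "M = \<Union>\<N>"
    using assms by (auto simp: meager_in_def)
  \<comment> \<open>\<open>meager_in\<close> asks for an exact union, not a cover, so each piece is
    cut down to \<open>N\<close>.\<close>
  have "nowhere_dense_in Y (K \<inter> N)" if "K \<in> \<N>" for K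
  proof -
    have "Y interior_of (Y closure_of (K \<inter> N)) \<subseteq> Y interior_of (Y closure_of K)"
      by (intro interior_of_mono closure_of_mono) auto
    then show ?thesis using \<N>(2)[OF that] by (auto simp: nowhere_dense_in_def)
  qed
  moreover have "N = \<Union>((\<lambda>K. K \<inter> N) ` \<N>)" using assms(2) \<N>(3) by auto
  ultimately show ?thesis
    unfolding meager_in_def using \<N>(1) by (intro exI[of _ "(\<lambda>K. K \<inter> N) ` \<N>"]) auto
qed

lemma meager_in_Un:
  assumes "meager_in Y M" "meager_in Y N"
  shows "meager_in Y (M \<union> N)"
proof -
  obtain \<M> \<N> where "countable \<M>" "\<forall>K\<in>\<M>. nowhere_dense_in Y K" "M = \<Union>\<M>"
    and "countable \<N>" "\<forall>K\<in>\<N>. nowhere_dense_in Y K" "N = \<Union>\<N>"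
    using assms unfolding meager_in_def by blast
  then show ?thesis
    unfolding meager_in_def by (intro exI[of _ "\<M> \<union> \<N>"]) auto
qed

text \<open>Singletons are closed by T1 and have empty interior since no point is isolated; a
  countable set is a countable union of them.\<close>

lemma meager_in_countable:
  assumes "t1_space Y" "no_isolated_points Y" "countable M" "M \<subseteq> topspace Y"
  shows "meager_in Y M"
proof -
  have "nowhere_dense_in Y {x}" if "x \<in> M" for x
  proof -
    have "Y closure_of {x} = {x}"
      using assms that by (intro closure_of_closedin) (auto simp: t1_space_closedin_singleton)
    moreover have "Y interior_of {x} = {}"
      using assms that unfolding interior_of_eq_empty
      by (metis no_isolated_points_def subset_iff subset_singletonD)
    ultimately show ?thesis using assms that by (auto simp: nowhere_dense_in_def)
  qed
  then show ?thesis
    unfolding meager_in_def using assms(3) by (intro exI[of _ "(\<lambda>x. {x}) ` M"]) auto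
qed

lemma admissible_F_com: "admissible Y (F_com Y)"
proof -
  have "meager_in Y {}" by (auto simp: meager_in_def intro: exI[of _ "{}"])
  moreover have "meager_in Y (topspace Y - G)" if "meager_in Y (topspace Y - F)" "F \<subseteq> G" for F G
    using that by (meson Diff_mono meager_in_subset subset_refl)
  moreover have "meager_in Y (topspace Y - U \<inter> V)"
    if "meager_in Y (topspace Y - U)" "meager_in Y (topspace Y - V)" for U V
    using meager_in_Un[OF that] by (simp add: Diff_Int)
  ultimately show ?thesis by (auto simp: admissible_def F_com_def)
qed

lemma F_com_subset_D_dense:
  assumes "compact_space Y" "Hausdorff_space Y"
  shows "F_com Y \<subseteq> D_dense Y"
proof
  fix S assume S: "S \<in> F_com Y"
  then obtain \<N> where \<N>: "countable \<N>" "\<And>K. K \<in> \<N> \<Longrightarrow> nowhere_dense_in Y K"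
      "topspace Y - S = \<Union>\<N>"
    by (auto simp: F_com_def meager_in_def)
  \<comment> \<open>Baire applies to closed sets with empty interior, so the nowhere dense pieces
    are replaced by their closures, which still cover the complement of \<open>S\<close>.\<close>
  have "Y interior_of \<Union>((closure_of) Y ` \<N>) = {}"
  proof (rule Baire_category_alt)
    show "completely_metrizable_space Y \<or> locally_compact_space Y \<and> regular_space Y"
      using assms by (simp add: compact_imp_locally_compact_space compact_Hausdorff_imp_regular_space)
  qed (use \<N> in \<open>auto simp: nowhere_dense_in_def\<close>)
  moreover have "topspace Y - S \<subseteq> \<Union>((closure_of) Y ` \<N>)"
    unfolding \<N>(3)
  proof (rule Union_least)
    fix K assume "K \<in> \<N>"
    then have "K \<subseteq> Y closure_of K"
      using \<N>(2) by (intro closure_of_subset) (simp add: nowhere_dense_in_def)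
    then show "K \<subseteq> \<Union>((closure_of) Y ` \<N>)" using \<open>K \<in> \<N>\<close> by blast
  qed
  ultimately have "Y interior_of (topspace Y - S) = {}"
    by (metis interior_of_mono subset_empty)
  then have "Y closure_of S = topspace Y"
    by (simp add: closure_of_interior_of)
  then show "S \<in> D_dense Y"
    using S by (auto simp: D_dense_def dense_in_space_def F_com_def)
qed

lemma US_modifier_F_com:
  assumes "t1_space Y" "no_isolated_points Y"
  shows "US_modifier Y A (F_com Y)"
  unfolding US_modifier_def
proof (intro allI impI)
  fix z :: "nat \<Rightarrow> _" and c
  assume *: "range z \<subseteq> topspace Y \<and> c \<in> topspace Y - A \<and> limitin Y z c sequentially"
  then have "meager_in Y (range z \<union> {c})"
    by (intro meager_in_countable[OF assms]) auto
  moreover have "topspace Y - (topspace Y - (range z \<union> {c})) = range z \<union> {c}"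
    using * by auto
  ultimately show "topspace Y - (range z \<union> {c}) \<in> F_com Y"
    by (simp add: F_com_def)
qed

section \<open>The cofinite modifier\<close>

lemma admissible_F_cof: "admissible Y (F_cof Y)"
proof -
  have "finite (topspace Y - G)" if "finite (topspace Y - F)" "F \<subseteq> G" for F G
    using that by (meson Diff_mono finite_subset subset_refl)
  moreover have "finite (topspace Y - U \<inter> V)"
    if "finite (topspace Y - U)" "finite (topspace Y - V)" for U V
    using that by (simp add: Diff_Int)
  ultimately show ?thesis by (auto simp: admissible_def F_cof_def)
qed

lemma F_cof_subset_D_dense:
  assumes "t1_space Y" "no_isolated_points Y"
  shows "F_cof Y \<subseteq> D_dense Y"
proof -
  have "S \<inter> T \<noteq> {}" if S: "finite (topspace Y - S)" and T: "openin Y T" "T \<noteq> {}" for S T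
  proof
    assume "S \<inter> T = {}"
    then have "T \<subseteq> topspace Y - S" using openin_subset[OF T(1)] by auto
    then show False
      using S infinite_openin_no_isolated_points[OF assms T] finite_subset by blast
  qed
  then show ?thesis by (auto simp: F_cof_def D_dense_def dense_in_space_iff)
qed

section \<open>The filter-modified quotient\<close>

lemma collapse_eq_iff: "collapse A x = collapse A y \<longleftrightarrow> x = y \<or> x \<in> A \<and> y \<in> A"
  by (auto simp: collapse_def)

lemma collapse_eq_point_iff: "collapse A y = A \<longleftrightarrow> y \<in> A"
  by (auto simp: collapse_def)

text \<open>Only points of \<open>A\<close> are identified with one another, so a common class would
  need a point of \<open>A\<close> in both sets.\<close>

lemma disjnt_collapse_images:
  assumes "disjnt U V" "A \<inter> V = {}"
  shows "disjnt (collapse A ` U) (collapse A ` V)"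
  using assms by (auto simp: disjnt_iff collapse_eq_iff)

lemma point_in_collapse_image:
  assumes "A \<noteq> {}" "A \<subseteq> U"
  shows "A \<in> collapse A ` U"
proof -
  obtain a where "a \<in> A" using assms(1) by blast
  then have "A = collapse A a" by (simp add: collapse_def)
  then show ?thesis using \<open>a \<in> A\<close> assms(2) by blast
qed

text \<open>Such a set is saturated, that is, a union of fibres of \<open>q\<close>. This allows
  open sets of the quotient to be built as images.\<close>

lemma collapse_preimage_image:
  assumes "U \<subseteq> topspace Y" "A \<subseteq> U \<or> A \<inter> U = {}"
  shows "{y \<in> topspace Y. collapse A y \<in> collapse A ` U} = U"
  using assms by (auto simp: image_iff collapse_eq_iff)

lemma fmq_open_image_nhd:
  assumes "openin Y U" "A \<subseteq> U" "U \<in> \<F>"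
  shows "fmq_open Y A \<F> (collapse A ` U)"
proof -
  have "U \<subseteq> topspace Y" using assms openin_subset by blast
  with assms show ?thesis
    by (simp add: fmq_open_def collapse_preimage_image image_mono)
qed

text \<open>The image misses \<open>*\<close>, so the modifier has no say: off \<open>A\<close> the
  quotient keeps the topology of \<open>Y\<close>.\<close>

lemma fmq_open_image_disjoint:
  assumes "openin Y U" "A \<inter> U = {}"
  shows "fmq_open Y A \<F> (collapse A ` U)"
proof -
  have "U \<subseteq> topspace Y" using assms openin_subset by blast
  moreover have "A \<notin> collapse A ` U"
    using assms(2) collapse_eq_point_iff[of A] by fastforce
  ultimately show ?thesis
    using assms by (simp add: fmq_open_def collapse_preimage_image image_mono)
qed

section \<open>The key intersection principle and density\<close>

lemma KIP_iff_dense_nhds: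
  "KIP Y A \<F> \<longleftrightarrow>
     (\<forall>U. openin (FMQ Y A \<F>) U \<and> A \<in> U \<longrightarrow> dense_in_space (FMQ Y A \<F>) U)"
  unfolding KIP_def dense_in_space_iff using openin_subset by blast

text \<open>This one equivalence yields the KIP for \<open>D_dense\<close>, its failure for every
  strictly larger admissible modifier, and the extremality of \<open>D_dense\<close>.\<close>

lemma KIP_iff_subset_D_dense:
  assumes Y: "regular_space Y" "t1_space Y" "no_isolated_points Y"
    and A: "finite A" "A \<noteq> {}" "A \<subseteq> topspace Y" and adm: "admissible Y \<F>"
  shows "KIP Y A \<F> \<longleftrightarrow> \<F> \<subseteq> D_dense Y"
proof -
  have op: "openin (FMQ Y A \<F>) = fmq_open Y A \<F>"
    using A adm by (intro openin_FMQ)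
  show ?thesis
  proof
    assume sub: "\<F> \<subseteq> D_dense Y"
    show "KIP Y A \<F>"
      unfolding KIP_def op
    proof (intro allI impI)
      fix U V assume UV: "fmq_open Y A \<F> U \<and> A \<in> U \<and> fmq_open Y A \<F> V \<and> V \<noteq> {}"
      let ?p = "\<lambda>U. {y \<in> topspace Y. collapse A y \<in> U}"
      have "dense_in_space Y (?p U)" using UV sub by (auto simp: fmq_open_def D_dense_def)
      moreover have "openin Y (?p V)" "?p V \<noteq> {}" using UV by (auto simp: fmq_open_def)
      ultimately have "?p U \<inter> ?p V \<noteq> {}" unfolding dense_in_space_iff by blast
      then show "U \<inter> V \<noteq> {}" by auto
    qed
  next
    assume kip: "KIP Y A \<F>"
    show "\<F> \<subseteq> D_dense Y"
    proof (rule ccontr)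
      assume "\<not> \<F> \<subseteq> D_dense Y"
      then obtain S where S: "S \<in> \<F>" "\<not> dense_in_space Y S" by (auto simp: D_dense_def)
      have S_sub: "S \<subseteq> topspace Y" using S adm by (auto simp: admissible_def)
      let ?W = "topspace Y - Y closure_of S"
      have W: "openin Y ?W" "?W \<noteq> {}"
        using S S_sub closure_of_subset_topspace[of Y S] by (auto simp: dense_in_space_def)
      \<comment> \<open>Finiteness of \<open>A\<close> enters here: the infinite set
        \<open>?W\<close> cannot lie inside \<open>A\<close>.\<close>
      then have "infinite ?W" using Y by (intro infinite_openin_no_isolated_points[of Y]) auto
      then obtain p where p: "p \<in> ?W" "p \<notin> A"
        using A(1) by (meson finite_subset subsetI)
      \<comment> \<open>Adding \<open>A\<close> to the set separated from \<open>p\<close> ensures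
        that \<open>?U\<close> below contains the whole class \<open>*\<close> and that the image of
        \<open>V\<close> avoids it.\<close>
      have "closedin Y (Y closure_of S \<union> A)"
        using Y(2) A by (auto simp: t1_space_closedin_finite)
      then obtain V where V: "openin Y V" "p \<in> V" "disjnt (Y closure_of S \<union> A) (Y closure_of V)"
        using Y(1) p unfolding regular_space by blast
      let ?U = "topspace Y - Y closure_of V"
      have V_sub: "V \<subseteq> Y closure_of V" using closure_of_subset[OF openin_subset[OF V(1)]] .
      have AU: "A \<subseteq> ?U" using V A by (auto simp: disjnt_iff)
      have "S \<subseteq> ?U" using V S_sub closure_of_subset[OF S_sub] by (auto simp: disjnt_iff)
      \<comment> \<open>Upward closure trades \<open>S\<close>, which may be neither open nor a
        superset of \<open>A\<close>, for an open member of \<open>\<F>\<close> containing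
        \<open>A\<close>.\<close>
      then have "?U \<in> \<F>" using adm S unfolding admissible_def by blast
      then have "fmq_open Y A \<F> (collapse A ` ?U)"
        using AU by (intro fmq_open_image_nhd) auto
      moreover have "A \<in> collapse A ` ?U"
        using A(2) AU by (rule point_in_collapse_image)
      moreover have "A \<inter> V = {}" using AU V_sub by auto
      then have "fmq_open Y A \<F> (collapse A ` V)"
        using V by (intro fmq_open_image_disjoint)
      moreover have "collapse A ` V \<noteq> {}" using V by auto
      ultimately have "collapse A ` ?U \<inter> collapse A ` V \<noteq> {}"
        using kip unfolding KIP_def op by blast
      then show False
        using V_sub \<open>A \<inter> V = {}\<close> unfolding disjoint_iff image_iff
        by (metis DiffD2 collapse_eq_iff subsetD)
    qed
  qed
qed

section \<open>Hausdorff quotients\<close>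

text \<open>By \<open>nhd\<close> the modifier excludes no open set around \<open>A\<close>, so this
  is the ordinary quotient by a finite set. The description \<open>op\<close> of the open sets is a
  hypothesis because for \<open>F_acc\<close> it comes from \<open>openin_FMQ_acc\<close>, not from
  admissibility.\<close>

lemma Hausdorff_space_FMQ:
  assumes Y: "Hausdorff_space Y" and A: "finite A" "A \<noteq> {}" "A \<subseteq> topspace Y"
    and op: "openin (FMQ Y A \<F>) = fmq_open Y A \<F>"
    and nhd: "\<And>U. openin Y U \<Longrightarrow> A \<subseteq> U \<Longrightarrow> U \<in> \<F>"
  shows "Hausdorff_space (FMQ Y A \<F>)"
proof -
  have A_closed: "closedin Y A"
    using Y A Hausdorff_imp_t1_space by (auto simp: t1_space_closedin_finite)
  \<comment> \<open>Of two distinct classes at most one is \<open>*\<close>, so up to symmetry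
    \<open>y\<close> lies off \<open>A\<close>.\<close>
  have sep: "\<exists>U V. fmq_open Y A \<F> U \<and> fmq_open Y A \<F> V \<and> collapse A x \<in> U \<and> collapse A y \<in> V
      \<and> disjnt U V"
    if xy: "x \<in> topspace Y" "y \<in> topspace Y" "y \<notin> A" "x \<noteq> y" for x y
  proof (cases "x \<in> A")
    case True
    \<comment> \<open>All of \<open>A\<close> has to be separated from \<open>y\<close> at once,
      hence the separation of compact sets.\<close>
    have "compactin Y A" "compactin Y {y}" using A xy by (auto intro: finite_imp_compactin)
    then obtain U V where UV: "openin Y U" "openin Y V" "A \<subseteq> U" "{y} \<subseteq> V" "disjnt U V"
      using Y xy unfolding Hausdorff_space_compact_sets
      by (metis disjnt_insert2 disjnt_empty2)
    then have "A \<inter> V = {}" by (auto simp: disjnt_iff)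
    then have "fmq_open Y A \<F> (collapse A ` U)" "fmq_open Y A \<F> (collapse A ` V)"
      using UV nhd fmq_open_image_nhd fmq_open_image_disjoint by metis+
    moreover have "disjnt (collapse A ` U) (collapse A ` V)"
      using UV(5) \<open>A \<inter> V = {}\<close> by (rule disjnt_collapse_images)
    ultimately show ?thesis using UV True by blast
  next
    case False
    obtain U V where UV: "openin Y U" "openin Y V" "x \<in> U" "y \<in> V" "disjnt U V"
      using Y xy unfolding Hausdorff_space_def by blast
    then have "fmq_open Y A \<F> (collapse A ` (U - A))" "fmq_open Y A \<F> (collapse A ` (V - A))"
      using A_closed by (auto intro!: fmq_open_image_disjoint)
    moreover have "disjnt (collapse A ` (U - A)) (collapse A ` (V - A))"
      using UV by (intro disjnt_collapse_images) (auto simp: disjnt_iff)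
    ultimately show ?thesis using UV False xy by blast
  qed
  have "topspace Y \<in> \<F>" using A by (intro nhd) auto
  then have top: "topspace (FMQ Y A \<F>) = collapse A ` topspace Y"
    using A op by (intro topspace_FMQ)
  show ?thesis
    unfolding Hausdorff_space_def op top
  proof (intro allI impI)
    fix l m assume lm: "l \<in> collapse A ` topspace Y \<and> m \<in> collapse A ` topspace Y \<and> l \<noteq> m"
    then obtain x y where xy: "l = collapse A x" "m = collapse A y" "x \<in> topspace Y" "y \<in> topspace Y"
      by blast
    then have ne: "x \<noteq> y" "x \<notin> A \<or> y \<notin> A" using lm by (auto simp: collapse_eq_iff)
    show "\<exists>U V. fmq_open Y A \<F> U \<and> fmq_open Y A \<F> V \<and> l \<in> U \<and> m \<in> V \<and> disjnt U V"
    proof (cases "y \<in> A")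
      case False
      then show ?thesis using sep[of x y] xy ne by blast
    next
      case True
      then show ?thesis using sep[of y x] xy ne by (metis disjnt_sym)
    qed
  qed
qed

section \<open>Unique sequential limits\<close>

lemma US_spaceD:
  assumes "US_space Z" "range s \<subseteq> topspace Z"
    "limitin Z s l sequentially" "limitin Z s m sequentially"
  shows "l = m"
  using assms by (simp add: US_space_def)

lemma US_modifierD:
  assumes "US_modifier Y A \<F>" "range z \<subseteq> topspace Y" "c \<in> topspace Y - A"
    "limitin Y z c sequentially"
  shows "topspace Y - (range z \<union> {c}) \<in> \<F>"
  using assms unfolding US_modifier_def by blast

text \<open>The modifier only removes open sets from the quotient topology, so \<open>q\<close>
  stays continuous.\<close>

lemma limitin_FMQ_collapse:
  assumes op: "openin (FMQ Y A \<F>) = fmq_open Y A \<F>"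
    and top: "topspace (FMQ Y A \<F>) = collapse A ` topspace Y"
    and z: "range z \<subseteq> topspace Y" "limitin Y z c sequentially"
  shows "limitin (FMQ Y A \<F>) (collapse A \<circ> z) (collapse A c) sequentially"
  unfolding limitin_def op top
proof (intro conjI allI impI)
  show "collapse A c \<in> collapse A ` topspace Y"
    using limitin_topspace[OF z(2)] by blast
  fix U assume U: "fmq_open Y A \<F> U \<and> collapse A c \<in> U"
  let ?p = "{y \<in> topspace Y. collapse A y \<in> U}"
  have "openin Y ?p" "c \<in> ?p"
    using U limitin_topspace[OF z(2)] by (auto simp: fmq_open_def)
  then have "eventually (\<lambda>n. z n \<in> ?p) sequentially"
    using z(2) unfolding limitin_def by blast
  then show "eventually (\<lambda>n. (collapse A \<circ> z) n \<in> U) sequentially"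
    by (rule eventually_mono) auto
qed

text \<open>On the open set \<open>Y - A\<close> the map \<open>q\<close> is a homeomorphism onto an
  open set, so a sequence converging to a point other than \<open>*\<close> eventually lifts to
  \<open>Y\<close>.\<close>

lemma limitin_FMQ_lift:
  assumes op: "openin (FMQ Y A \<F>) = fmq_open Y A \<F>"
    and A: "closedin Y A" and c: "c \<in> topspace Y - A"
    and s: "limitin (FMQ Y A \<F>) s (collapse A c) sequentially"
  obtains z where "range z \<subseteq> topspace Y - A" "limitin Y z c sequentially"
    "eventually (\<lambda>n. s n = collapse A (z n)) sequentially"
proof -
  have ev: "eventually (\<lambda>n. s n \<in> collapse A ` (U - A)) sequentially"
    if "openin Y U" "c \<in> U" for U
  proof -
    have "fmq_open Y A \<F> (collapse A ` (U - A))"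
      using that A by (intro fmq_open_image_disjoint) auto
    moreover have "collapse A c \<in> collapse A ` (U - A)" using that c by blast
    ultimately show ?thesis using s unfolding limitin_def op by blast
  qed
  \<comment> \<open>The default \<open>c\<close> covers the finitely many terms without a lift;
    lying off \<open>A\<close>, it keeps the range of \<open>z\<close> off \<open>A\<close>.\<close>
  define z where "z n = (if s n \<in> collapse A ` (topspace Y - A)
                         then SOME y. y \<in> topspace Y - A \<and> s n = collapse A y else c)" for n
  have z: "z n \<in> topspace Y - A \<and> s n = collapse A (z n)"
    if "s n \<in> collapse A ` (topspace Y - A)" for n
  proof -
    have "\<exists>y. y \<in> topspace Y - A \<and> s n = collapse A y" using that by blast
    from someI_ex[OF this] show ?thesis using that by (simp add: z_def)
  qed
  have "range z \<subseteq> topspace Y - A"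
  proof safe
    fix n
    show "z n \<in> topspace Y" using z[of n] c by (cases "s n \<in> collapse A ` (topspace Y - A)") (auto simp: z_def)
    assume "z n \<in> A"
    then show False using z[of n] c by (cases "s n \<in> collapse A ` (topspace Y - A)") (auto simp: z_def)
  qed
  moreover have "limitin Y z c sequentially"
    unfolding limitin_def
  proof (intro conjI allI impI)
    show "c \<in> topspace Y" using c by blast
    fix U assume U: "openin Y U \<and> c \<in> U"
    show "eventually (\<lambda>n. z n \<in> U) sequentially"
    proof (rule eventually_mono[OF ev])
      fix n assume "s n \<in> collapse A ` (U - A)"
      then obtain u where u: "u \<in> U - A" "s n = collapse A u" by blast
      then have "s n \<in> collapse A ` (topspace Y - A)" using U openin_subset by blast
      with z[of n] u have "collapse A (z n) = collapse A u" by simp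
      with u show "z n \<in> U" by (auto simp: collapse_eq_iff)
    qed (use U in auto)
  qed
  moreover have "eventually (\<lambda>n. s n = collapse A (z n)) sequentially"
    by (rule eventually_mono[OF ev[of "topspace Y"]]) (use c z in auto)
  ultimately show thesis by (rule that)
qed

text \<open>Two limits other than \<open>*\<close> lift to limits in the Hausdorff space
  \<open>Y\<close>. A limit \<open>*\<close> beside another limit is excluded by
  \<open>US_modifier\<close>.\<close>

lemma US_space_FMQ:
  assumes Y: "Hausdorff_space Y" and A: "closedin Y A" "A \<noteq> {}"
    and adm: "admissible Y \<F>" and us: "US_modifier Y A \<F>"
  shows "US_space (FMQ Y A \<F>)"
proof -
  have A_sub: "A \<subseteq> topspace Y" using A by (simp add: closedin_subset)
  have op: "openin (FMQ Y A \<F>) = fmq_open Y A \<F>"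
    using A A_sub adm by (intro openin_FMQ)
  have top: "topspace (FMQ Y A \<F>) = collapse A ` topspace Y"
    using A A_sub adm op by (intro topspace_FMQ) (auto simp: admissible_def)
  have not_both: False
    if sA: "limitin (FMQ Y A \<F>) s A sequentially" and c: "c \<in> topspace Y - A"
      and sc: "limitin (FMQ Y A \<F>) s (collapse A c) sequentially" for s c
  proof -
    obtain z where z: "range z \<subseteq> topspace Y - A" "limitin Y z c sequentially"
      "eventually (\<lambda>n. s n = collapse A (z n)) sequentially"
      using limitin_FMQ_lift[OF op A(1) c sc] .
    let ?U = "topspace Y - (range z \<union> {c})"
    \<comment> \<open>A sequence together with its limit is compact, hence closed. Its complement
      \<open>?U\<close> is thus open, and the image of \<open>?U\<close> is a neighbourhood of
      \<open>*\<close> that the lifted terms never enter.\<close>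
    have "compactin Y (insert c (range z))"
      using z by (intro compactin_sequence_with_limit[of Y z]) auto
    then have "closedin Y (range z \<union> {c})"
      using Y by (simp add: compactin_imp_closedin)
    then have "openin Y ?U" by blast
    moreover have "A \<subseteq> ?U" using z(1) c A_sub by auto
    moreover have "?U \<in> \<F>" using z c by (intro US_modifierD[OF us]) auto
    ultimately have "fmq_open Y A \<F> (collapse A ` ?U)" by (intro fmq_open_image_nhd)
    moreover have "A \<in> collapse A ` ?U"
      using A(2) \<open>A \<subseteq> ?U\<close> by (rule point_in_collapse_image)
    ultimately have "eventually (\<lambda>n. s n \<in> collapse A ` ?U) sequentially"
      using sA unfolding limitin_def op by blast
    with z(3) have "eventually (\<lambda>n. s n = collapse A (z n) \<and> s n \<in> collapse A ` ?U) sequentially"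
      by (rule eventually_conj)
    then obtain n where "collapse A (z n) \<in> collapse A ` ?U"
      by (metis (mono_tags, lifting) eventually_sequentially order_refl)
    moreover have "z n \<notin> A" using z(1) by auto
    ultimately show False by (auto simp: collapse_eq_iff)
  qed
  show ?thesis
    unfolding US_space_def
  proof (intro allI impI)
    fix s l m
    assume "range s \<subseteq> topspace (FMQ Y A \<F>) \<and> limitin (FMQ Y A \<F>) s l sequentially
      \<and> limitin (FMQ Y A \<F>) s m sequentially"
    then have l: "limitin (FMQ Y A \<F>) s l sequentially" and m: "limitin (FMQ Y A \<F>) s m sequentially"
      by auto
    obtain x where x: "x \<in> topspace Y" "l = collapse A x"
      using limitin_topspace[OF l] unfolding top by (elim imageE)
    obtain y where y: "y \<in> topspace Y" "m = collapse A y"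
      using limitin_topspace[OF m] unfolding top by (elim imageE)
    consider "x \<in> A" "y \<in> A" | "x \<in> A" "y \<notin> A" | "x \<notin> A" "y \<in> A" | "x \<notin> A" "y \<notin> A" by blast
    then show "l = m"
    proof cases
      case 1
      then show ?thesis using x y by (simp add: collapse_def)
    next
      case 2
      then have "l = A" using x by (simp add: collapse_def)
      then show ?thesis using not_both[of s y] l m y 2 by blast
    next
      case 3
      then have "m = A" using y by (simp add: collapse_def)
      then show ?thesis using not_both[of s x] l m x 3 by blast
    next
      case 4
      obtain z where z: "range z \<subseteq> topspace Y - A" "limitin Y z x sequentially"
        "eventually (\<lambda>n. s n = collapse A (z n)) sequentially"
        using limitin_FMQ_lift[OF op A(1), of x s] l x 4 by (metis DiffI)
      obtain w where w: "range w \<subseteq> topspace Y - A" "limitin Y w y sequentially"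
        "eventually (\<lambda>n. s n = collapse A (w n)) sequentially"
        using limitin_FMQ_lift[OF op A(1), of y s] m y 4 by (metis DiffI)
      \<comment> \<open>The two lifts agree wherever both represent \<open>s\<close>, since
        \<open>collapse A\<close> is injective off \<open>A\<close>.\<close>
      have "eventually (\<lambda>n. z n = w n) sequentially"
        using z(3) w(3)
      proof eventually_elim
        case (elim n)
        then have "collapse A (z n) = collapse A (w n)" by simp
        moreover have "z n \<notin> A" using z(1) by auto
        ultimately show ?case by (auto simp: collapse_eq_iff)
      qed
      then have "limitin Y w x sequentially" using z(2) by (rule limitin_transform_eventually)
      then have "x = y" using w(2) Y by (auto intro: limitin_Hausdorff_unique)
      then show ?thesis using x y by simp
    qed
  qed
qed

section \<open>Quotients that are not US\<close>

text \<open>The only neighbourhood of \<open>*\<close> is the whole space, so a constant sequence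
  elsewhere converges to \<open>*\<close> as well.\<close>

lemma not_US_space_FMQ_singleton_topspace:
  assumes A: "A \<noteq> {}" "A \<subseteq> topspace Y" "A \<noteq> topspace Y"
  shows "\<not> US_space (FMQ Y A {topspace Y})"
proof -
  have op: "openin (FMQ Y A {topspace Y}) = fmq_open Y A {topspace Y}"
    using A by (intro openin_FMQ admissible_singleton_topspace)
  have top: "topspace (FMQ Y A {topspace Y}) = collapse A ` topspace Y"
    using A op by (intro topspace_FMQ) auto
  obtain c where c: "c \<in> topspace Y" "c \<notin> A" using A by blast
  have A_top: "A \<in> collapse A ` topspace Y"
    using A(1,2) by (rule point_in_collapse_image)
  let ?s = "\<lambda>n::nat. collapse A c"
  have "limitin (FMQ Y A {topspace Y}) ?s A sequentially"
    unfolding limitin_def op top using A_top c by (auto simp: fmq_open_def)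
  moreover have "limitin (FMQ Y A {topspace Y}) ?s (collapse A c) sequentially"
    using c top by (simp add: limitin_def)
  moreover have "A \<noteq> collapse A c" using c collapse_eq_point_iff by metis
  moreover have "range ?s \<subseteq> topspace (FMQ Y A {topspace Y})" using c top by auto
  ultimately show ?thesis using US_spaceD by metis
qed

text \<open>The infinite range rules out the modifier condition directly. For the space, a
  neighbourhood of \<open>*\<close> omits only finitely many points of \<open>Y\<close>, and terms
  that converge to \<open>c\<close> without equalling it eventually avoid these.\<close>

lemma not_US_F_cof:
  assumes Y: "t1_space Y" and A: "A \<noteq> {}" "A \<subseteq> topspace Y"
    and z: "range z \<subseteq> topspace Y" "infinite (range z)" "limitin Y z c sequentially"
    and c: "c \<in> topspace Y - A"
  shows "\<not> US_modifier Y A (F_cof Y) \<and> \<not> US_space (FMQ Y A (F_cof Y))"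
proof
  have "range z \<subseteq> topspace Y - (topspace Y - (range z \<union> {c}))" using z(1) by auto
  then have "topspace Y - (range z \<union> {c}) \<notin> F_cof Y"
    using z(2) finite_subset by (auto simp: F_cof_def)
  then show "\<not> US_modifier Y A (F_cof Y)"
    using US_modifierD z(1,3) c by metis
next
  have op: "openin (FMQ Y A (F_cof Y)) = fmq_open Y A (F_cof Y)"
    using A by (intro openin_FMQ admissible_F_cof)
  have top: "topspace (FMQ Y A (F_cof Y)) = collapse A ` topspace Y"
    using A op by (intro topspace_FMQ) (auto simp: F_cof_def)
  \<comment> \<open>The value \<open>c\<close> has to be skipped: a neighbourhood of \<open>*\<close> may miss it, and \<open>z\<close> may take it
    infinitely often.\<close>
  let ?N = "{n. z n \<noteq> c}"
  have "infinite ?N"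
  proof
    assume "finite ?N"
    moreover have "range z \<subseteq> insert c (z ` ?N)" by auto
    ultimately show False using z(2) by (meson finite_imageI finite_insert finite_subset)
  qed
  define w where "w = z \<circ> enumerate ?N"
  have w_top: "range w \<subseteq> topspace Y" using z(1) by (auto simp: w_def)
  have w_ne: "w n \<noteq> c" for n using enumerate_in_set[OF \<open>infinite ?N\<close>, of n] by (simp add: w_def)
  have w_lim: "limitin Y w c sequentially"
    unfolding w_def using strict_mono_enumerate[OF \<open>infinite ?N\<close>] z(3)
    by (rule limitin_subsequence)
  have "limitin (FMQ Y A (F_cof Y)) (collapse A \<circ> w) A sequentially"
    unfolding limitin_def op top
  proof (intro conjI allI impI)
    show "A \<in> collapse A ` topspace Y" using A by (rule point_in_collapse_image)
    fix U assume U: "fmq_open Y A (F_cof Y) U \<and> A \<in> U"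
    let ?p = "{y \<in> topspace Y. collapse A y \<in> U}"
    have "finite (topspace Y - ?p)" using U by (auto simp: fmq_open_def F_cof_def)
    \<comment> \<open>Taking \<open>c\<close> out of the finite exceptional set makes the complement
      an open neighbourhood of \<open>c\<close>.\<close>
    then have "closedin Y (topspace Y - ?p - {c})"
      using Y by (auto simp: t1_space_closedin_finite)
    then have "openin Y (topspace Y - (topspace Y - ?p - {c}))" by blast
    then have "eventually (\<lambda>n. w n \<in> topspace Y - (topspace Y - ?p - {c})) sequentially"
      using w_lim c unfolding limitin_def by blast
    then show "eventually (\<lambda>n. (collapse A \<circ> w) n \<in> U) sequentially"
      by (rule eventually_mono) (use w_ne in auto)
  qed
  moreover have "limitin (FMQ Y A (F_cof Y)) (collapse A \<circ> w) (collapse A c) sequentially"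
    using op top w_top w_lim by (rule limitin_FMQ_collapse)
  moreover have "range (collapse A \<circ> w) \<subseteq> topspace (FMQ Y A (F_cof Y))"
    using w_top top by auto
  moreover have "A \<noteq> collapse A c" using c collapse_eq_point_iff by (metis DiffD2)
  ultimately show "\<not> US_space (FMQ Y A (F_cof Y))" using US_spaceD by metis
qed

section \<open>Existence of infinite convergent sequences\<close>

lemma first_countable_imp_infinite_convergent_sequence:
  assumes fc: "first_countable Y" and Y: "t1_space Y" "no_isolated_points Y" and c: "c \<in> topspace Y"
  obtains z where "range z \<subseteq> topspace Y" "infinite (range z)" "limitin Y z c sequentially"
proof -
  obtain \<B> where \<B>: "countable \<B>" "\<And>V. V \<in> \<B> \<Longrightarrow> openin Y V"
      "\<And>U. openin Y U \<Longrightarrow> c \<in> U \<Longrightarrow> \<exists>V\<in>\<B>. c \<in> V \<and> V \<subseteq> U"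
    using fc c unfolding first_countable_def by metis
  let ?\<C> = "{V \<in> \<B>. c \<in> V}"
  have C: "countable ?\<C>" "?\<C> \<noteq> {}"
    using \<B>(1) \<B>(3)[OF openin_topspace c] by auto
  \<comment> \<open>Finite intersections turn an enumeration of the local base, possibly with
    repetitions, into a decreasing one.\<close>
  define W where "W n = (\<Inter>i\<le>n. from_nat_into ?\<C> i)" for n
  have V: "from_nat_into ?\<C> i \<in> ?\<C>" for i using C(2) by (rule from_nat_into)
  have W: "openin Y (W n)" "c \<in> W n" for n
    unfolding W_def using V \<B>(2) by (auto intro!: openin_Inter)
  have "\<exists>y. y \<in> W n \<and> y \<noteq> c" for n
  proof -
    have "infinite (W n)"
      using W[of n] by (intro infinite_openin_no_isolated_points[OF Y]) auto
    then have "\<not> W n \<subseteq> {c}" by (meson finite.emptyI finite_insert finite_subset)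
    then show ?thesis by auto
  qed
  then obtain z where z: "\<And>n. z n \<in> W n \<and> z n \<noteq> c" by metis
  have z_top: "range z \<subseteq> topspace Y" using z W openin_subset by blast
  have lim: "limitin Y z c sequentially"
    unfolding limitin_def
  proof (intro conjI allI impI c)
    fix U assume "openin Y U \<and> c \<in> U"
    then obtain V where "V \<in> ?\<C>" "V \<subseteq> U" using \<B>(3) by blast
    moreover from this obtain i where "from_nat_into ?\<C> i = V"
      using C(1) from_nat_into_surj by metis
    ultimately have "W n \<subseteq> U" if "i \<le> n" for n using that by (auto simp: W_def)
    then show "eventually (\<lambda>n. z n \<in> U) sequentially"
      using z unfolding eventually_sequentially by blast
  qed
  have "infinite (range z)"
  proof
    assume "finite (range z)"
    \<comment> \<open>All terms differ from \<open>c\<close>, so a finite range would leave a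
      neighbourhood of \<open>c\<close> that contains no term.\<close>
    then have "closedin Y (range z)" using Y(1) z_top by (auto simp: t1_space_closedin_finite)
    then have "openin Y (topspace Y - range z)" by blast
    moreover have "c \<in> topspace Y - range z" using c z by (auto simp: image_iff)
    ultimately have "eventually (\<lambda>n. z n \<in> topspace Y - range z) sequentially"
      using lim unfolding limitin_def by blast
    then show False by (auto simp: eventually_sequentially)
  qed
  then show thesis using z_top lim by (intro that)
qed

text \<open>An isolated point would be a proper nonempty clopen subset of a connected space.\<close>

lemma no_isolated_points_unit_interval: "no_isolated_points (top_of_set {0..1::real})"
  unfolding no_isolated_points_def
proof (intro ballI notI)
  fix y :: real assume "y \<in> topspace (top_of_set {0..1})" and op: "openin (top_of_set {0..1}) {y}"
  have "connected {0..1::real}" by simp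
  moreover have "closedin (top_of_set {0..1}) {y}"
    using \<open>y \<in> _\<close> by (simp add: closed_subset)
  ultimately have "{y} = {0..1}" using op by (auto simp: connected_clopen)
  then show False by (metis atLeastAtMost_singleton_iff zero_neq_one)
qed

text \<open>\<open>F_cof\<close> violates \<open>US_modifier\<close> exactly when some sequence with
  infinitely many terms converges off \<open>A\<close>. The interval, being metrizable, provides one
  with limit 0, off the collapsed set \<open>{1}\<close>.\<close>

lemma not_US_F_cof_unit_interval:
  defines "Z \<equiv> top_of_set {0..1::real}"
  shows "compact_space Z \<and> Hausdorff_space Z \<and> no_isolated_points Z \<and>
    finite {1::real} \<and> {1} \<noteq> {} \<and> {1} \<subseteq> topspace Z \<and>
    \<not> US_modifier Z {1} (F_cof Z) \<and> \<not> US_space (FMQ Z {1} (F_cof Z))"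
proof -
  have Z: "compact_space Z" "Hausdorff_space Z" "first_countable Z"
    unfolding Z_def
    by (auto simp: compact_space_subtopology Hausdorff_space_subtopology
        intro!: metrizable_imp_first_countable metrizable_space_subtopology
          metrizable_space_euclidean)
  have nip: "no_isolated_points Z" using no_isolated_points_unit_interval by (simp add: Z_def)
  have t1: "t1_space Z" using Z Hausdorff_imp_t1_space by blast
  have 0: "0 \<in> topspace Z - {1}" by (simp add: Z_def)
  then obtain z where "range z \<subseteq> topspace Z" "infinite (range z)" "limitin Z z 0 sequentially"
    using first_countable_imp_infinite_convergent_sequence[OF Z(3) t1 nip, of 0] by blast
  then have "\<not> US_modifier Z {1} (F_cof Z) \<and> \<not> US_space (FMQ Z {1} (F_cof Z))"
    using t1 0 by (intro not_US_F_cof) (auto simp: Z_def)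
  then show ?thesis using Z nip by (auto simp: Z_def)
qed

theorem theorem6p11:
  fixes Y :: "'a topology" and A :: "'a set"
  assumes "compact_space Y" and "Hausdorff_space Y" and "no_isolated_points Y"
    and "finite A" and "A \<noteq> {}" and "A \<subseteq> topspace Y"
  shows
    "((\<forall>U. openin (FMQ Y A (D_dense Y)) U \<and> A \<in> U \<longrightarrow>
          dense_in_space (FMQ Y A (D_dense Y)) U) \<and>
      KIP Y A (D_dense Y))
   \<and> (\<forall>\<F>. admissible Y \<F> \<and> D_dense Y \<subset> \<F> \<longrightarrow>
        (\<exists>U. openin (FMQ Y A \<F>) U \<and> A \<in> U \<and> \<not> dense_in_space (FMQ Y A \<F>) U) \<and>
        \<not> KIP Y A \<F>)
   \<and> (Hausdorff_space (FMQ Y A (F_acc Y A)) \<and> Hausdorff_space (FMQ Y A (Pow (topspace Y))))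
   \<and> ((\<exists>\<F>. admissible Y \<F> \<and> \<F> \<subseteq> D_dense Y \<and> US_space (FMQ Y A \<F>)) \<and>
      (\<exists>\<F>. admissible Y \<F> \<and> \<F> \<subseteq> D_dense Y \<and> \<not> US_space (FMQ Y A \<F>)) \<and>
      admissible Y (F_com Y) \<and> F_com Y \<subseteq> D_dense Y \<and>
      US_modifier Y A (F_com Y) \<and> US_space (FMQ Y A (F_com Y)) \<and>
      admissible Y (F_cof Y) \<and> F_cof Y \<subseteq> D_dense Y \<and>
      ((\<exists>z c. range z \<subseteq> topspace Y \<and> infinite (range z) \<and> c \<in> topspace Y - A \<and>
          limitin Y z c sequentially)
        \<longrightarrow> \<not> US_modifier Y A (F_cof Y) \<and> \<not> US_space (FMQ Y A (F_cof Y))) \<and>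
      (first_countable Y
        \<longrightarrow> \<not> US_modifier Y A (F_cof Y) \<and> \<not> US_space (FMQ Y A (F_cof Y))) \<and>
      (\<exists>(Z :: real topology) B. compact_space Z \<and> Hausdorff_space Z \<and> no_isolated_points Z \<and>
          finite B \<and> B \<noteq> {} \<and> B \<subseteq> topspace Z \<and>
          \<not> US_modifier Z B (F_cof Z) \<and> \<not> US_space (FMQ Z B (F_cof Z))))
   \<and> (admissible Y (D_dense Y) \<and> KIP Y A (D_dense Y) \<and>
      (\<forall>\<F>. admissible Y \<F> \<and> KIP Y A \<F> \<longrightarrow> \<F> \<subseteq> D_dense Y))"
proof -
  have t1: "t1_space Y" using assms(2) Hausdorff_imp_t1_space by blast
  have reg: "regular_space Y" using assms(1,2) by (rule compact_Hausdorff_imp_regular_space)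
  have A_closed: "closedin Y A" using assms t1 by (auto simp: t1_space_closedin_finite)
  have KIP_iff: "KIP Y A \<F> \<longleftrightarrow> \<F> \<subseteq> D_dense Y" if "admissible Y \<F>" for \<F>
    using reg t1 assms that by (intro KIP_iff_subset_D_dense)
  have "topspace Y \<noteq> {}" using assms by auto
  then have inf: "infinite (topspace Y)"
    using t1 assms by (intro infinite_openin_no_isolated_points[of Y]) auto
  \<comment> \<open>A point off the finite set \<open>A\<close> is needed for both the failure of US
    with \<open>{topspace Y}\<close> and the limit \<open>c\<close> in the first countable
    case.\<close>
  then have A_ne: "A \<noteq> topspace Y" using assms by auto
  have acc: "Hausdorff_space (FMQ Y A (F_acc Y A))"
    using assms t1 by (intro Hausdorff_space_FMQ openin_FMQ_acc openin_subset_F_acc)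
  have pow: "Hausdorff_space (FMQ Y A (Pow (topspace Y)))"
    using assms
    by (intro Hausdorff_space_FMQ openin_FMQ admissible_Pow) (auto dest: openin_subset)
  have com: "admissible Y (F_com Y)" "F_com Y \<subseteq> D_dense Y" "US_modifier Y A (F_com Y)"
    using admissible_F_com F_com_subset_D_dense[OF assms(1,2)] US_modifier_F_com[OF t1 assms(3)]
    by auto
  have com_US: "US_space (FMQ Y A (F_com Y))"
    using assms(2) A_closed assms(5) com(1,3) by (rule US_space_FMQ)
  have ex_not_US: "\<exists>\<F>. admissible Y \<F> \<and> \<F> \<subseteq> D_dense Y \<and> \<not> US_space (FMQ Y A \<F>)"
    using admissible_singleton_topspace[of Y] admissible_D_dense[of Y] assms A_ne
      not_US_space_FMQ_singleton_topspace[of A Y]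
    by (intro exI[of _ "{topspace Y}"]) (auto simp: admissible_def)
  have cof: "\<not> US_modifier Y A (F_cof Y) \<and> \<not> US_space (FMQ Y A (F_cof Y))"
    if "\<exists>z c. range z \<subseteq> topspace Y \<and> infinite (range z) \<and> c \<in> topspace Y - A \<and>
          limitin Y z c sequentially"
    using that not_US_F_cof[OF t1 assms(5,6)] by blast
  have fc: "\<not> US_modifier Y A (F_cof Y) \<and> \<not> US_space (FMQ Y A (F_cof Y))"
    if "first_countable Y"
  proof -
    obtain c where "c \<in> topspace Y - A" using A_ne assms by blast
    then show ?thesis
      using first_countable_imp_infinite_convergent_sequence[OF that t1 assms(3), of c] cof
      by (metis DiffD1)
  qed
  have cof_adm: "admissible Y (F_cof Y)" "F_cof Y \<subseteq> D_dense Y"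
    using admissible_F_cof F_cof_subset_D_dense[OF t1 assms(3)] by auto
  have kipD: "KIP Y A (D_dense Y)" using KIP_iff admissible_D_dense by blast
  have not_dense: "\<forall>\<F>. admissible Y \<F> \<and> D_dense Y \<subset> \<F> \<longrightarrow>
      (\<exists>U. openin (FMQ Y A \<F>) U \<and> A \<in> U \<and> \<not> dense_in_space (FMQ Y A \<F>) U) \<and>
      \<not> KIP Y A \<F>"
  proof (intro allI impI)
    fix \<F> assume "admissible Y \<F> \<and> D_dense Y \<subset> \<F>"
    then have "\<not> KIP Y A \<F>" using KIP_iff[of \<F>] by blast
    then show "(\<exists>U. openin (FMQ Y A \<F>) U \<and> A \<in> U \<and> \<not> dense_in_space (FMQ Y A \<F>) U) \<and>
        \<not> KIP Y A \<F>"
      using KIP_iff_dense_nhds[of Y A \<F>] by blast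
  qed
  have least: "\<forall>\<F>. admissible Y \<F> \<and> KIP Y A \<F> \<longrightarrow> \<F> \<subseteq> D_dense Y"
    using KIP_iff by blast
  show ?thesis
  proof (intro conjI)
    show "\<forall>U. openin (FMQ Y A (D_dense Y)) U \<and> A \<in> U \<longrightarrow>
        dense_in_space (FMQ Y A (D_dense Y)) U"
      using kipD unfolding KIP_iff_dense_nhds .
    show "\<exists>(Z :: real topology) B. compact_space Z \<and> Hausdorff_space Z \<and> no_isolated_points Z \<and>
          finite B \<and> B \<noteq> {} \<and> B \<subseteq> topspace Z \<and>
          \<not> US_modifier Z B (F_cof Z) \<and> \<not> US_space (FMQ Z B (F_cof Z))"
      using not_US_F_cof_unit_interval by (intro exI)
    show "\<exists>\<F>. admissible Y \<F> \<and> \<F> \<subseteq> D_dense Y \<and> US_space (FMQ Y A \<F>)"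
      using com com_US by blast
  qed (fact kipD not_dense acc pow com com_US ex_not_US cof_adm admissible_D_dense least
      | intro impI, erule cof fc)+
qed

end
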